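(* Let $F:\mathbb{R}^n\to\mathbb{R}^n$ be monotone and continuous, and let $\Omega\subseteq\mathbb{R}^n$ be a nonempty closed convex set. Let $w_0\in\mathbb{R}^n$ be any initial point, let $H$ be a real symmetric positive definite $n\times n$ matrix, and let $\lambda\in(0,2)$. For all $k\ge 0$, let $\tilde{w}_k\in\Omega$ be generated by the PPA step $$(w-\tilde{w}_k)^T\big[F(\tilde{w}_k)+H(\tilde{w}_k-w_k)\big]\ge 0\quad\text{for all } w\in\Omega,$$ and let $w_{k+1}$ be given by the relaxation step $$w_{k+1}=w_k+\lambda(\tilde{w}_k-w_k).$$ Then, for any integer $N>0$, the point $\bar{w}_N=\frac{1}{N+1}\sum_{k=0}^N\tilde{w}_k$ satisfies $$(\bar{w}_N-w)^TF(w)\le\frac{1}{2(\lambda N+2)}\|w-w_0\|_H^2\quad\text{for all } w\in\Omega.$$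
   Context: A mapping $F:\mathbb{R}^n\to\mathbb{R}^n$ is monotone if $(x-y)^T(F(x)-F(y))\ge 0$ for all $x,y\in\mathbb{R}^n$. For a symmetric positive definite matrix $H$, $\|x\|_H=\sqrt{x^THx}$. *)

theory Defs
  imports "HOL-Analysis.Analysis"
begin

definition monotone_mapping :: "(real ^ 'n \<Rightarrow> real ^ 'n) \<Rightarrow> bool" where
  "monotone_mapping F \<longleftrightarrow> (\<forall>x y. (x - y) \<bullet> (F x - F y) \<ge> 0)"

definition sym_pos_def :: "real ^ 'n ^ 'n \<Rightarrow> bool" where
  "sym_pos_def H \<longleftrightarrow> transpose H = H \<and> (\<forall>x. x \<noteq> 0 \<longrightarrow> x \<bullet> (H *v x) > 0)"

definition norm_wrt :: "real ^ 'n ^ 'n \<Rightarrow> real ^ 'n \<Rightarrow> real" where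
  "norm_wrt H x = sqrt (x \<bullet> (H *v x))"

text \<open>The proximal point step is a variational inequality that constrains the
  point \<open>wt\<close>; it is a relation, not a choice of solution.\<close>

definition ppa_step ::
  "(real ^ 'n \<Rightarrow> real ^ 'n) \<Rightarrow> (real ^ 'n) set \<Rightarrow> real ^ 'n ^ 'n \<Rightarrow> real ^ 'n \<Rightarrow> real ^ 'n \<Rightarrow> bool" where
  "ppa_step F \<Omega> H w wt \<longleftrightarrow>
     wt \<in> \<Omega> \<and> (\<forall>v\<in>\<Omega>. (v - wt) \<bullet> (F wt + H *v (wt - w)) \<ge> 0)"

end

theory Submission
  imports Defs
begin

text \<open>
  Write \<open>e\<^sub>k = w\<^sub>k - wt\<^sub>k\<close> and let \<open>n = N + 1\<close>; all norms are
  \<open>H\<close>-norms.  The variational inequality at a point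
  \<open>v \<in> \<Omega>\<close>, together with monotonicity, gives
  \<open>(wt\<^sub>k - v) \<bullet> F v \<le> (wt\<^sub>k - v) \<bullet> H e\<^sub>k\<close>, and the relaxation step turns the right-hand side
  into a telescoping difference of squared \<open>H\<close>-distances to \<open>v\<close>, minus
  \<open>(1 - lam / 2) \<parallel>e\<^sub>k\<parallel>\<^sup>2\<close> (\<open>ppa_gap_step\<close>).

  The usual estimate drops both the final distance \<open>\<parallel>w\<^sub>n - v\<parallel>\<^sup>2\<close> and the residuals \<open>\<parallel>e\<^sub>k\<parallel>\<^sup>2\<close>,
  and ends with the denominator \<open>2 lam (N + 1)\<close>.  The sharper denominator
  \<open>2 (lam N + 2)\<close> comes from keeping both.  Each is controlled by the single vector
  \<open>S = e\<^sub>0 + \<dots> + e\<^sub>N\<close>: the iterates satisfy \<open>w\<^sub>n = w\<^sub>0 - lam S\<close>, and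
  \<open>\<parallel>S\<parallel>\<^sup>2 \<le> n \<Sum> \<parallel>e\<^sub>k\<parallel>\<^sup>2\<close> (\<open>norm_wrt_sum_squared_le\<close>).  With \<open>d = w\<^sub>0 - v\<close> the summed gap is
  therefore at most \<open>d \<bullet> H S - (mu / 2) \<parallel>S\<parallel>\<^sup>2\<close>, where
  \<open>mu = lam + (2 - lam) / n = (lam N + 2) / n\<close>.  Maximising this concave quadratic over \<open>S\<close>
  (\<open>inner_minus_square_le\<close>) bounds it by \<open>\<parallel>d\<parallel>\<^sup>2 / (2 mu)\<close>, and averaging over the \<open>n\<close> points
  gives the claim.
\<close>

lemma norm_wrt_squared:
  assumes "sym_pos_def H"
  shows "(norm_wrt H x)\<^sup>2 = x \<bullet> (H *v x)"
proof (cases "x = 0")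
  case False
  then have "x \<bullet> (H *v x) > 0"
    using assms by (simp add: sym_pos_def_def)
  then show ?thesis
    by (simp add: norm_wrt_def)
qed (simp add: norm_wrt_def)

lemma sym_pos_def_inner_commute:
  assumes "sym_pos_def H"
  shows "x \<bullet> (H *v y) = y \<bullet> (H *v x)"
  using assms by (metis dot_lmul_matrix inner_commute sym_pos_def_def vector_transpose_matrix)

lemma norm_wrt_squared_diff:
  assumes "sym_pos_def H"
  shows "(norm_wrt H (x - c *\<^sub>R y))\<^sup>2
    = (norm_wrt H x)\<^sup>2 - 2 * c * (x \<bullet> (H *v y)) + c\<^sup>2 * (norm_wrt H y)\<^sup>2"
  unfolding norm_wrt_squared[OF assms]
  using sym_pos_def_inner_commute[OF assms, of y x]
  by (simp add: matrix_vector_mult_diff_distrib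
      matrix_vector_mult_scaleR inner_diff_left inner_diff_right power2_eq_square algebra_simps)

text \<open>The vector \<open>S\<close> that maximises the left-hand side is \<open>d\<close> divided by \<open>mu\<close>; the difference of
  the two sides is the square of the distance to that maximiser, up to a factor.\<close>

lemma inner_minus_square_le:
  assumes "sym_pos_def H" and "mu > 0"
  shows "d \<bullet> (H *v S) - mu / 2 * (norm_wrt H S)\<^sup>2 \<le> (norm_wrt H d)\<^sup>2 / (2 * mu)"
proof -
  have "0 \<le> (norm_wrt H (d - mu *\<^sub>R S))\<^sup>2"
    by simp
  then have "2 * mu * (d \<bullet> (H *v S)) - mu\<^sup>2 * (norm_wrt H S)\<^sup>2 \<le> (norm_wrt H d)\<^sup>2"
    unfolding norm_wrt_squared_diff[OF assms(1)] by simp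
  then show ?thesis
    using assms(2) by (simp add: field_simps power2_eq_square)
qed

text \<open>The Cauchy--Schwarz inequality for a sum of vectors, obtained by summing the tangent-line
  inequality of the squared norm at the mean.\<close>

lemma norm_wrt_sum_squared_le:
  assumes "sym_pos_def H" and "finite A"
  shows "(norm_wrt H (\<Sum>k\<in>A. e k))\<^sup>2 \<le> real (card A) * (\<Sum>k\<in>A. (norm_wrt H (e k))\<^sup>2)"
proof (cases "A = {}")
  case True
  then show ?thesis
    by (simp add: norm_wrt_def)
next
  case False
  define n where "n = real (card A)"
  define S where "S = (\<Sum>k\<in>A. e k)"
  have n: "n > 0"
    using False assms(2) by (simp add: n_def card_gt_0_iff)
  have "0 \<le> (\<Sum>k\<in>A. (norm_wrt H (e k - (1 / n) *\<^sub>R S))\<^sup>2)"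
    by (simp add: sum_nonneg)
  also have "\<dots> = (\<Sum>k\<in>A. (norm_wrt H (e k))\<^sup>2) - 2 * (1 / n) * (S \<bullet> (H *v S))
      + n * ((1 / n)\<^sup>2 * (norm_wrt H S)\<^sup>2)"
    unfolding norm_wrt_squared_diff[OF assms(1)] sum.distrib sum_subtractf
    by (simp add: n_def S_def inner_sum_left flip: sum_distrib_left sum_divide_distrib)
  also have "\<dots> = (\<Sum>k\<in>A. (norm_wrt H (e k))\<^sup>2) - (norm_wrt H S)\<^sup>2 / n"
    unfolding norm_wrt_squared[OF assms(1)] using n by (simp add: field_simps power2_eq_square)
  finally show ?thesis
    using n by (simp add: n_def S_def field_simps)
qed

text \<open>Monotonicity moves \<open>F\<close> from the iterate to the comparison point \<open>v\<close>.  The rest is the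
  expansion of \<open>\<parallel>w - v - lam (w - wt)\<parallel>\<^sup>2\<close>, solved for its cross term.\<close>

lemma ppa_gap_step:
  assumes "monotone_mapping F" and "sym_pos_def H" and "lam > 0"
    and "ppa_step F \<Omega> H w wt" and "v \<in> \<Omega>"
  shows "(wt - v) \<bullet> F v
    \<le> ((norm_wrt H (w - v))\<^sup>2 - (norm_wrt H (w + lam *\<^sub>R (wt - w) - v))\<^sup>2) / (2 * lam)
      - (1 - lam / 2) * (norm_wrt H (w - wt))\<^sup>2"
proof -
  define e where "e = w - wt"
  have "(wt - v) \<bullet> (F wt - F v) \<ge> 0"
    using assms(1) by (simp add: monotone_mapping_def)
  moreover have "(v - wt) \<bullet> (F wt - H *v e) \<ge> 0"
    using assms(4,5) by (auto simp: ppa_step_def e_def matrix_vector_mult_diff_distrib algebra_simps)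
  ultimately have "(wt - v) \<bullet> F v \<le> (wt - v) \<bullet> (H *v e)"
    by (simp add: inner_diff_left inner_diff_right)
  also have "\<dots> = (w - v) \<bullet> (H *v e) - (norm_wrt H e)\<^sup>2"
    by (simp add: norm_wrt_squared[OF assms(2)] e_def inner_diff_left)
  finally have gap: "(wt - v) \<bullet> F v \<le> (w - v) \<bullet> (H *v e) - (norm_wrt H e)\<^sup>2" .
  have "w + lam *\<^sub>R (wt - w) - v = (w - v) - lam *\<^sub>R e"
    by (simp add: e_def algebra_simps)
  then have "(norm_wrt H (w + lam *\<^sub>R (wt - w) - v))\<^sup>2
      = (norm_wrt H (w - v))\<^sup>2 - 2 * lam * ((w - v) \<bullet> (H *v e)) + lam\<^sup>2 * (norm_wrt H e)\<^sup>2"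
    by (simp only: norm_wrt_squared_diff[OF assms(2)])
  then have "((norm_wrt H (w - v))\<^sup>2 - (norm_wrt H (w + lam *\<^sub>R (wt - w) - v))\<^sup>2) / (2 * lam)
      = (w - v) \<bullet> (H *v e) - lam / 2 * (norm_wrt H e)\<^sup>2"
    using assms(3) by (simp add: field_simps power2_eq_square)
  with gap show ?thesis
    by (simp add: e_def algebra_simps)
qed

text \<open>Summing the one-step bounds expresses both what telescopes and the residual sum through
  the total residual \<open>S\<close>, over which the right-hand side is still to be maximised.  The
  coefficient \<open>1 - lam / 2\<close> of the residual sum must be nonnegative for the Cauchy--Schwarz bound to
  go in the right direction; this is where \<open>lam \<le> 2\<close> enters.\<close>

lemma ppa_gap_sum:
  fixes w wt :: "nat \<Rightarrow> real ^ 'n" and N :: nat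
  defines "S \<equiv> (\<Sum>k\<le>N. w k - wt k)"
  assumes "monotone_mapping F" and H: "sym_pos_def H" and lam: "0 < lam" "lam \<le> 2"
    and step: "\<And>k. ppa_step F \<Omega> H (w k) (wt k)"
    and relax: "\<And>k. w (Suc k) = w k + lam *\<^sub>R (wt k - w k)"
    and "v \<in> \<Omega>"
  shows "(\<Sum>k\<le>N. (wt k - v) \<bullet> F v)
    \<le> (w 0 - v) \<bullet> (H *v S) - (lam + (2 - lam) / (real N + 1)) / 2 * (norm_wrt H S)\<^sup>2"
proof -
  define D where "D k = (norm_wrt H (w k - v))\<^sup>2" for k
  define R where "R = (\<Sum>k\<le>N. (norm_wrt H (w k - wt k))\<^sup>2)"
  have "(wt k - v) \<bullet> F v
      \<le> (D k - D (Suc k)) / (2 * lam) - (1 - lam / 2) * (norm_wrt H (w k - wt k))\<^sup>2" for k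
    using ppa_gap_step[OF assms(2) H lam(1) step \<open>v \<in> \<Omega>\<close>, of k] by (simp add: D_def relax)
  then have "(\<Sum>k\<le>N. (wt k - v) \<bullet> F v)
      \<le> (\<Sum>k\<le>N. (D k - D (Suc k)) / (2 * lam) - (1 - lam / 2) * (norm_wrt H (w k - wt k))\<^sup>2)"
    by (intro sum_mono) blast
  also have "\<dots> = (D 0 - D (Suc N)) / (2 * lam) - (1 - lam / 2) * R"
    unfolding sum_subtractf R_def
    by (simp add: sum_telescope flip: sum_divide_distrib sum_distrib_left sum_subtractf)
  also have "(D 0 - D (Suc N)) / (2 * lam) = (w 0 - v) \<bullet> (H *v S) - lam / 2 * (norm_wrt H S)\<^sup>2"
  proof -
    have "w m = w 0 - lam *\<^sub>R (\<Sum>k<m. w k - wt k)" for m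
      by (induction m) (simp_all add: relax scaleR_add_right scaleR_diff_right)
    from this[of "Suc N"] have "w (Suc N) - v = (w 0 - v) - lam *\<^sub>R S"
      by (simp add: S_def lessThan_Suc_atMost)
    then have "D (Suc N) = D 0 - 2 * lam * ((w 0 - v) \<bullet> (H *v S)) + lam\<^sup>2 * (norm_wrt H S)\<^sup>2"
      by (simp only: D_def norm_wrt_squared_diff[OF H])
    then show ?thesis
      using lam(1) by (simp add: field_simps power2_eq_square)
  qed
  finally have sum: "(\<Sum>k\<le>N. (wt k - v) \<bullet> F v)
      \<le> (w 0 - v) \<bullet> (H *v S) - lam / 2 * (norm_wrt H S)\<^sup>2 - (1 - lam / 2) * R" .
  have "(norm_wrt H S)\<^sup>2 / (real N + 1) \<le> R"
    using norm_wrt_sum_squared_le[OF H, of "{..N}" "\<lambda>k. w k - wt k"]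
    by (simp add: S_def R_def divide_le_eq mult.commute add.commute)
  then have "(1 - lam / 2) * ((norm_wrt H S)\<^sup>2 / (real N + 1)) \<le> (1 - lam / 2) * R"
    using lam(2) by (intro mult_left_mono) auto
  moreover have "(lam + (2 - lam) / (real N + 1)) / 2 * (norm_wrt H S)\<^sup>2
      = lam / 2 * (norm_wrt H S)\<^sup>2 + (1 - lam / 2) * ((norm_wrt H S)\<^sup>2 / (real N + 1))"
    by (simp add: field_simps)
  ultimately show ?thesis
    using sum by linarith
qed

theorem theorem5p1:
  fixes F :: "real ^ 'n \<Rightarrow> real ^ 'n"
    and \<Omega> :: "(real ^ 'n) set"
    and H :: "real ^ 'n ^ 'n"
    and lam :: real
    and w0 :: "real ^ 'n"
    and w wt :: "nat \<Rightarrow> real ^ 'n"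
    and N :: nat
  assumes "monotone_mapping F" and "continuous_on UNIV F"
    and "\<Omega> \<noteq> {}" and "closed \<Omega>" and "convex \<Omega>"
    and "sym_pos_def H"
    and "0 < lam" and "lam < 2"
    and "w 0 = w0"
    and "\<And>k. ppa_step F \<Omega> H (w k) (wt k)"
    and "\<And>k. w (Suc k) = w k + lam *\<^sub>R (wt k - w k)"
    and "N > 0"
  shows "\<forall>v\<in>\<Omega>. ((1 / (real N + 1)) *\<^sub>R (\<Sum>k=0..N. wt k) - v) \<bullet> F v
           \<le> 1 / (2 * (lam * real N + 2)) * (norm_wrt H (v - w0))\<^sup>2"
proof
  fix v assume v: "v \<in> \<Omega>"
  define n where "n = real N + 1"
  define mu where "mu = lam + (2 - lam) / n"
  define S where "S = (\<Sum>k\<le>N. w k - wt k)"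
  have n: "n > 0"
    by (simp add: n_def)
  have mu: "mu > 0"
    using assms(7,8) n by (simp add: mu_def add_pos_pos)
  have n_mu: "n * mu = lam * real N + 2"
    using n by (simp add: mu_def distrib_left) (simp add: n_def algebra_simps)
  have "(\<Sum>k\<le>N. (wt k - v) \<bullet> F v) \<le> (w0 - v) \<bullet> (H *v S) - mu / 2 * (norm_wrt H S)\<^sup>2"
    using ppa_gap_sum[where w = w and wt = wt and N = N, OF assms(1,6,7) _ assms(10,11) v] assms(8,9)
    by (simp add: S_def mu_def n_def)
  also have "\<dots> \<le> (norm_wrt H (w0 - v))\<^sup>2 / (2 * mu)"
    by (rule inner_minus_square_le[OF assms(6) mu])
  also have "(norm_wrt H (w0 - v))\<^sup>2 = (norm_wrt H (v - w0))\<^sup>2"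
    using norm_wrt_squared[OF assms(6)]
    by (simp add: matrix_vector_mult_diff_distrib inner_diff_left inner_diff_right)
  finally have "(\<Sum>k\<le>N. (wt k - v) \<bullet> F v) / n \<le> (norm_wrt H (v - w0))\<^sup>2 / (2 * mu) / n"
    using n by (intro divide_right_mono) auto
  moreover have "(norm_wrt H (v - w0))\<^sup>2 / (2 * mu) / n
      = 1 / (2 * (lam * real N + 2)) * (norm_wrt H (v - w0))\<^sup>2"
    by (simp add: mult.commute flip: n_mu)
  moreover have "((1 / n) *\<^sub>R (\<Sum>k=0..N. wt k) - v) \<bullet> F v = (\<Sum>k\<le>N. (wt k - v) \<bullet> F v) / n"
  proof -
    have "(\<Sum>k\<le>N. (wt k - v) \<bullet> F v) = (\<Sum>k\<le>N. wt k) \<bullet> F v - n * (v \<bullet> F v)"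
      by (simp add: n_def inner_diff_left sum_subtractf inner_sum_left algebra_simps)
    then show ?thesis
      using n by (simp add: inner_diff_left field_simps atLeast0AtMost)
  qed
  ultimately show "((1 / (real N + 1)) *\<^sub>R (\<Sum>k=0..N. wt k) - v) \<bullet> F v
      \<le> 1 / (2 * (lam * real N + 2)) * (norm_wrt H (v - w0))\<^sup>2"
    by (simp only: n_def)
qed

end
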